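(* Let $r\ge 1$ and let $m_1,\dots,m_r\ge1$ be integers such that $q_{m_i}$ and $q_{m_j}$ are coprime for all $1\le i<j\le r$, where $q_k=(k+1)^k-1$. Let $\Gamma=Q_{m_1}*\cdots*Q_{m_r}$, with presentation $$\Gamma=\langle x_{1},t_{1},\ldots,x_{r},t_{r}\mid \rho_{m_1}(x_{1},t_{1}),\ x_{1}^{m_1},\ \ldots,\ \rho_{m_r}(x_{r},t_{r}),\ x_{r}^{m_r}\rangle .$$ Let $F$ be the free group on $x_1,t_1,\dots,x_r,t_r$, let $R$ be the normal closure in $F$ of these $2r$ relators, and let $R_{\mathrm{ab}}=R/[R,R]$ be the relation module of this presentation. Then $R_{\mathrm{ab}}$ is generated as a $\mathbf{Z}\Gamma$-module by the images of the $r+1$ elements $\rho_{m_1}(x_1,t_1),\ldots,\rho_{m_r}(x_r,t_r)$ and $x_{1}^{m_1}x_2^{m_2}\cdots x_{r}^{m_r}$ of $R$.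
   Context: For letters $x,t$ and an integer $k\ge1$, $\rho_k(x,t)$ denotes the word $(txt^{-1})\,x\,(txt^{-1})^{-1}x^{-k-1}$, and $Q_k$ is the group $\langle x,t\mid \rho_k(x,t),\,x^{k}\rangle$. For a presentation $\Gamma=F/R$ with $F$ free and $R$ normal in $F$, the conjugation action of $F$ on $R$ induces an action of $\Gamma$ on $R_{\mathrm{ab}}=R/[R,R]$, making it a $\mathbf{Z}\Gamma$-module, called the relation module of the presentation. *)

theory Defs
  imports "HOL-Algebra.Generated_Groups" "HOL-Algebra.Module"
begin

section \<open>Free groups\<close>

text \<open>A letter of a group word is a pair of a sign and a generator: \<open>(True, s)\<close> is \<open>s\<close> and
  \<open>(False, s)\<close> is \<open>s\<^sup>-\<^sup>1\<close>. The free group is realised on the freely reduced words.\<close>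

type_synonym 'a word = "(bool \<times> 'a) list"

definition flip :: "bool \<times> 'a \<Rightarrow> bool \<times> 'a" where
  "flip p = (\<not> fst p, snd p)"

definition reduced :: "'a word \<Rightarrow> bool" where
  "reduced w \<longleftrightarrow> (\<forall>i. Suc i < length w \<longrightarrow> w ! Suc i \<noteq> flip (w ! i))"

fun red_cons :: "bool \<times> 'a \<Rightarrow> 'a word \<Rightarrow> 'a word" where
  "red_cons p [] = [p]"
| "red_cons p (q # w) = (if q = flip p then w else p # q # w)"

text \<open>For reduced words \<open>u\<close> and \<open>v\<close>, \<open>foldr red_cons u v\<close> is the reduced form of
  the concatenation \<open>u @ v\<close>: the letters of \<open>u\<close> are prepended to \<open>v\<close> one at a time, starting
  with the last, each one cancelling against the head if possible.\<close>

definition free_group :: "'a set \<Rightarrow> 'a word monoid" where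
  "free_group S = \<lparr>carrier = {w. reduced w \<and> snd ` set w \<subseteq> S},
                   monoid.mult = (\<lambda>u v. foldr red_cons u v),
                   one = []\<rparr>"

definition letter :: "'a \<Rightarrow> 'a word" where
  "letter s = [(True, s)]"

lemma flip_flip [simp]: "flip (flip p) = p"
  by (simp add: flip_def)

lemma snd_flip [simp]: "snd (flip p) = snd p"
  by (simp add: flip_def)

lemma reduced_Nil [simp]: "reduced []"
  by (simp add: reduced_def)

lemma reduced_singleton [simp]: "reduced [p]"
  by (simp add: reduced_def)

lemma reduced_Cons_Cons [simp]: "reduced (p # q # w) \<longleftrightarrow> q \<noteq> flip p \<and> reduced (q # w)"
proof -
  have "(\<forall>i. Suc i < length (p # q # w) \<longrightarrow> (p # q # w) ! Suc i \<noteq> flip ((p # q # w) ! i)) \<longleftrightarrow>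
    q \<noteq> flip p \<and> (\<forall>i. Suc i < length (q # w) \<longrightarrow> (q # w) ! Suc i \<noteq> flip ((q # w) ! i))"
    (is "(\<forall>i. ?A i) \<longleftrightarrow> ?B \<and> (\<forall>i. ?C i)")
  proof -
    have 1: "?A 0 \<longleftrightarrow> ?B" by simp
    have 2: "?A (Suc i) \<longleftrightarrow> ?C i" for i by simp
    have "(\<forall>i. ?A i) \<longleftrightarrow> ?A 0 \<and> (\<forall>i. ?A (Suc i))"
      by (metis not0_implies_Suc)
    then show ?thesis unfolding 1 2 .
  qed
  then show ?thesis unfolding reduced_def .
qed

lemma reduced_ConsD: "reduced (p # w) \<Longrightarrow> reduced w"
  by (cases w) auto

lemma reduced_red_cons: "reduced w \<Longrightarrow> reduced (red_cons p w)"
  by (cases w) (auto dest: reduced_ConsD)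

lemma reduced_foldr: "reduced w \<Longrightarrow> reduced (foldr red_cons u w)"
  by (induction u) (auto intro: reduced_red_cons)

lemma snd_red_cons: "snd ` set (red_cons p w) \<subseteq> insert (snd p) (snd ` set w)"
  by (cases w) auto

lemma snd_foldr: "snd ` set (foldr red_cons u w) \<subseteq> snd ` set u \<union> snd ` set w"
proof (induction u)
  case (Cons p u)
  have "snd ` set (foldr red_cons (p # u) w) \<subseteq> insert (snd p) (snd ` set (foldr red_cons u w))"
    using snd_red_cons[of p "foldr red_cons u w"] by simp
  also have "\<dots> \<subseteq> insert (snd p) (snd ` set u \<union> snd ` set w)"
    using Cons.IH by (rule insert_mono)
  finally show ?case by simp
qed simp

lemma red_cons_flip: "reduced w \<Longrightarrow> red_cons p (red_cons (flip p) w) = w"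
  by (cases w; cases "tl w") auto

lemma foldr_red_cons:
  assumes "reduced w"
  shows "foldr red_cons (red_cons p v) w = red_cons p (foldr red_cons v w)"
proof (cases v)
  case (Cons q v')
  then show ?thesis
    using red_cons_flip[OF reduced_foldr[OF assms]] by auto
qed simp

lemma foldr_red_cons_assoc:
  assumes "reduced w"
  shows "foldr red_cons (foldr red_cons u v) w = foldr red_cons u (foldr red_cons v w)"
  by (induction u) (auto simp: foldr_red_cons[OF assms])

lemma foldr_red_cons_Nil: "reduced u \<Longrightarrow> foldr red_cons u [] = u"
proof (induction u)
  case (Cons p u)
  then show ?case by (cases u) (auto dest: reduced_ConsD)
qed simp

lemma foldr_red_cons_inverse:
  "reduced w \<Longrightarrow> foldr red_cons (rev (map flip u)) (foldr red_cons u w) = w"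
proof (induction u)
  case (Cons p u)
  then show ?case
    using red_cons_flip[OF reduced_foldr[OF Cons.prems], of "flip p" u] by simp
qed simp

lemma reduced_red_word: "reduced (foldr red_cons u [])"
  by (rule reduced_foldr) simp

lemma group_free_group: "group (free_group S)"
proof (rule groupI)
  fix u v assume uv: "u \<in> carrier (free_group S)" "v \<in> carrier (free_group S)"
  then have "snd ` set u \<union> snd ` set v \<subseteq> S" by (simp add: free_group_def)
  with snd_foldr[of u v] have "snd ` set (foldr red_cons u v) \<subseteq> S" by (rule order_trans)
  with uv show "u \<otimes>\<^bsub>free_group S\<^esub> v \<in> carrier (free_group S)"
    by (simp add: free_group_def reduced_foldr)
next
  fix u assume u: "u \<in> carrier (free_group S)"
  define v where "v = foldr red_cons (rev (map flip u)) []"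
  have "snd ` set v \<subseteq> snd ` set u"
    using snd_foldr[of "rev (map flip u)" "[]"] by (auto simp: v_def image_image)
  also have "\<dots> \<subseteq> S" using u by (simp add: free_group_def)
  finally have "v \<in> carrier (free_group S)"
    by (simp add: free_group_def v_def reduced_red_word)
  moreover have "foldr red_cons v u = []"
    using u foldr_red_cons_inverse[of "[]" u]
    by (simp add: v_def free_group_def foldr_red_cons_assoc foldr_red_cons_Nil)
  ultimately show "\<exists>v\<in>carrier (free_group S). v \<otimes>\<^bsub>free_group S\<^esub> u = \<one>\<^bsub>free_group S\<^esub>"
    by (auto simp: free_group_def)
qed (auto simp: free_group_def foldr_red_cons_assoc)

lemma letter_in_free_group: "s \<in> S \<Longrightarrow> letter s \<in> carrier (free_group S)"
  by (simp add: free_group_def letter_def)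


section \<open>Normal closures and relation modules\<close>

definition normal_closure :: "('a, 'b) monoid_scheme \<Rightarrow> 'a set \<Rightarrow> 'a set" where
  "normal_closure G A = \<Inter>{N. N \<lhd> G \<and> A \<subseteq> N}"

lemma (in group) normal_closure_normal:
  assumes "A \<subseteq> carrier G"
  shows "normal_closure G A \<lhd> G"
proof -
  have ne: "{N. N \<lhd> G \<and> A \<subseteq> N} \<noteq> {}" using assms normal_self by auto
  have "subgroup (normal_closure G A) G"
    unfolding normal_closure_def
    by (rule subgroups_Inter) (use ne normal_imp_subgroup in auto)
  then show ?thesis
    unfolding normal_inv_iff by (auto simp: normal_closure_def normal_inv_iff)
qed

text \<open>The integral group ring \<open>\<int>G\<close>: finitely supported functions \<open>G \<rightarrow> \<int>\<close> under convolution.\<close>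

definition group_ring :: "('g, 'b) monoid_scheme \<Rightarrow> ('g \<Rightarrow> int) ring" where
  "group_ring G =
     \<lparr>carrier = {a. finite {g. a g \<noteq> 0} \<and> {g. a g \<noteq> 0} \<subseteq> carrier G},
      monoid.mult = (\<lambda>a b g. if g \<in> carrier G
                      then \<Sum>h | h \<in> carrier G \<and> a h \<noteq> 0. a h * b (inv\<^bsub>G\<^esub> h \<otimes>\<^bsub>G\<^esub> g)
                      else 0),
      one = (\<lambda>g. if g = \<one>\<^bsub>G\<^esub> then 1 else 0),
      zero = (\<lambda>g. 0),
      add = (\<lambda>a b g. a g + b g)\<rparr>"

definition abelianization :: "('a, 'b) monoid_scheme \<Rightarrow> 'a set \<Rightarrow> 'a set monoid" where
  "abelianization F R = F\<lparr>carrier := R\<rparr> Mod (derived F R)"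

text \<open>For cosets \<open>g = R f\<close> and \<open>c = [R,R] r\<close>, the set below is the coset \<open>[R,R] (f r f\<^sup>-\<^sup>1)\<close>; see
  the lemma \<open>conj_action_coset\<close>.\<close>

definition conj_action :: "('a, 'b) monoid_scheme \<Rightarrow> 'a set \<Rightarrow> 'a set \<Rightarrow> 'a set" where
  "conj_action F g c = {f \<otimes>\<^bsub>F\<^esub> r \<otimes>\<^bsub>F\<^esub> inv\<^bsub>F\<^esub> f | f r. f \<in> g \<and> r \<in> c}"

text \<open>The group \<open>R\<^sub>a\<^sub>b\<close> is written multiplicatively in \<^const>\<open>abelianization\<close>, so the scalar multiple
  of \<open>c\<close> by \<open>\<Sum> a\<^sub>g g\<close> is the product of the powers \<open>(g \<cdot> c)\<^bsup>a\<^sub>g\<^esup>\<close>. The record type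
  \<^typ>\<open>('r, 'm) module\<close> extends that of rings; its fields \<open>mult\<close> and \<open>one\<close> play no role for
  modules.\<close>

definition relation_module ::
    "('a, 'b) monoid_scheme \<Rightarrow> 'a set \<Rightarrow> ('a set \<Rightarrow> int, 'a set) module" where
  "relation_module F R =
     \<lparr>carrier = carrier (abelianization F R),
      monoid.mult = monoid.mult (abelianization F R),
      one = one (abelianization F R),
      zero = one (abelianization F R),
      add = monoid.mult (abelianization F R),
      smult = (\<lambda>a c. finprod (abelianization F R)
                       (\<lambda>g. conj_action F g c [^]\<^bsub>abelianization F R\<^esub> a g) {g. a g \<noteq> 0})\<rparr>"

definition generated_submodule ::
    "('r, 'b) ring_scheme \<Rightarrow> ('r, 'm, 'c) module_scheme \<Rightarrow> 'm set \<Rightarrow> 'm set" where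
  "generated_submodule K M A = \<Inter>{H. submodule H K M \<and> A \<subseteq> H}"

lemma (in group) conj_action_coset:
  assumes N: "R \<lhd> G" and f: "f \<in> carrier G" and r: "r \<in> R"
  shows "conj_action G (R #> f) (derived G R #> r) = derived G R #> (f \<otimes> r \<otimes> inv f)"
proof -
  interpret R: normal R G by (rule N)
  define D where "D = derived G R"
  interpret D: normal D G unfolding D_def by (rule derived_is_normal[OF N])
  have Dc: "d \<in> carrier G" if "d \<in> D" for d using that D.subset by auto
  have Rc: "d \<in> carrier G" if "d \<in> R" for d using that R.subset by auto
  have rc: "r \<in> carrier G" using r Rc by auto
  define s where "s = f \<otimes> r \<otimes> inv f"
  have s: "s \<in> R" using N f r by (auto simp: s_def normal_inv_iff)
  have sc: "s \<in> carrier G" using s Rc by auto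
  have conjD: "g \<otimes> d \<otimes> inv g \<in> D" if "d \<in> D" "g \<in> carrier G" for d g
    using D.normal_axioms that by (auto simp: normal_inv_iff)
  have 1: "(n \<otimes> f) \<otimes> (d \<otimes> r) \<otimes> inv (n \<otimes> f) \<in> D #> s" if n: "n \<in> R" and d: "d \<in> D" for n d
  proof -
    have nc: "n \<in> carrier G" and dc: "d \<in> carrier G" using n d Rc Dc by auto
    define d' where "d' = f \<otimes> d \<otimes> inv f"
    have d': "d' \<in> D" "d' \<in> carrier G" using conjD[OF d f] Dc by (auto simp: d'_def)
    have "n \<otimes> s \<otimes> inv n \<otimes> inv s \<in> D"
      unfolding D_def derived_def using n s by (intro generate.incl) auto
    moreover have "n \<otimes> d' \<otimes> inv n \<in> D" using conjD d' nc by auto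
    ultimately have e: "(n \<otimes> d' \<otimes> inv n) \<otimes> (n \<otimes> s \<otimes> inv n \<otimes> inv s) \<in> D"
      by (rule D.m_closed[rotated])
    have cancel: "inv g \<otimes> (g \<otimes> y) = y" if "g \<in> carrier G" "y \<in> carrier G" for g y
      using that by (simp add: m_assoc[symmetric])
    have "(n \<otimes> f) \<otimes> (d \<otimes> r) \<otimes> inv (n \<otimes> f)
        = (n \<otimes> d' \<otimes> inv n) \<otimes> (n \<otimes> s \<otimes> inv n \<otimes> inv s) \<otimes> s"
      using nc dc d' f rc sc
      by (simp add: m_assoc inv_mult_group cancel) (simp add: d'_def s_def m_assoc cancel)
    with e show ?thesis by (auto simp: r_coset_def)
  qed
  have 2: "\<exists>n\<in>R. \<exists>d'\<in>D. d \<otimes> s = (n \<otimes> f) \<otimes> (d' \<otimes> r) \<otimes> inv (n \<otimes> f)"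
    if d: "d \<in> D" for d
  proof (intro bexI)
    have dc: "d \<in> carrier G" using d Dc by auto
    have cancel: "g \<otimes> (inv g \<otimes> y) = y" "inv g \<otimes> (g \<otimes> y) = y"
      if "g \<in> carrier G" "y \<in> carrier G" for g y
      using that by (simp_all add: m_assoc[symmetric])
    show "d \<otimes> s = (\<one> \<otimes> f) \<otimes> ((inv f \<otimes> d \<otimes> f) \<otimes> r) \<otimes> inv (\<one> \<otimes> f)"
      using f dc rc by (simp add: s_def m_assoc cancel)
    show "inv f \<otimes> d \<otimes> f \<in> D" using conjD[OF d inv_closed[OF f]] f by simp
  qed simp
  have "conj_action G (R #> f) (D #> r) = D #> s"
  proof (intro subset_antisym subsetI)
    fix z assume "z \<in> conj_action G (R #> f) (D #> r)"
    then obtain n d where "n \<in> R" "d \<in> D" "z = (n \<otimes> f) \<otimes> (d \<otimes> r) \<otimes> inv (n \<otimes> f)"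
      unfolding conj_action_def r_coset_def by blast
    then show "z \<in> D #> s" using 1 by simp
  next
    fix z assume "z \<in> D #> s"
    then obtain d where "d \<in> D" "z = d \<otimes> s" unfolding r_coset_def by blast
    with 2[of d] show "z \<in> conj_action G (R #> f) (D #> r)"
      unfolding conj_action_def r_coset_def by blast
  qed
  then show ?thesis by (simp only: D_def s_def)
qed


lemma (in group) comm_group_abelianization:
  "subgroup R G \<Longrightarrow> comm_group (abelianization G R)"
  using derived_quot_of_subgroup_is_comm_group[of R] derived_consistent[of R R]
  by (simp add: abelianization_def)


section \<open>The presentation\<close>

definition rho :: "('a, 'b) monoid_scheme \<Rightarrow> nat \<Rightarrow> 'a \<Rightarrow> 'a \<Rightarrow> 'a" where
  "rho G k x t =
     (t \<otimes>\<^bsub>G\<^esub> x \<otimes>\<^bsub>G\<^esub> inv\<^bsub>G\<^esub> t) \<otimes>\<^bsub>G\<^esub> x \<otimes>\<^bsub>G\<^esub> inv\<^bsub>G\<^esub> (t \<otimes>\<^bsub>G\<^esub> x \<otimes>\<^bsub>G\<^esub> inv\<^bsub>G\<^esub> t)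
       \<otimes>\<^bsub>G\<^esub> x [^]\<^bsub>G\<^esub> (- int k - 1)"

datatype gen = X nat | T nat

definition free_xt :: "nat \<Rightarrow> gen word monoid" where
  "free_xt r = free_group (X ` {1..r} \<union> T ` {1..r})"

definition rho_rel :: "nat \<Rightarrow> (nat \<Rightarrow> nat) \<Rightarrow> nat \<Rightarrow> gen word" where
  "rho_rel r m i = rho (free_xt r) (m i) (letter (X i)) (letter (T i))"

definition power_rel :: "nat \<Rightarrow> (nat \<Rightarrow> nat) \<Rightarrow> nat \<Rightarrow> gen word" where
  "power_rel r m i = letter (X i) [^]\<^bsub>free_xt r\<^esub> m i"

definition relators :: "nat \<Rightarrow> (nat \<Rightarrow> nat) \<Rightarrow> gen word set" where
  "relators r m = rho_rel r m ` {1..r} \<union> power_rel r m ` {1..r}"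

text \<open>The ordered product \<open>x\<^sub>1\<^bsup>m\<^sub>1\<^esup> x\<^sub>2\<^bsup>m\<^sub>2\<^esup> \<cdots> x\<^sub>r\<^bsup>m\<^sub>r\<^esup>\<close>:\<close>

definition power_prod :: "nat \<Rightarrow> (nat \<Rightarrow> nat) \<Rightarrow> gen word" where
  "power_prod r m =
     foldr (\<otimes>\<^bsub>free_xt r\<^esub>) (map (power_rel r m) [1..<Suc r]) \<one>\<^bsub>free_xt r\<^esub>"

definition q :: "nat \<Rightarrow> nat" where
  "q k = (k + 1) ^ k - 1"

end

theory Submission
  imports Defs "HOL-Algebra.Multiplicative_Group"
begin

text \<open>Let \<open>N \<subseteq> R\<close> be the normal subgroup of \<open>F\<close> mapping onto a submodule that contains the
  \<open>r + 1\<close> elements, and compute modulo \<open>N\<close>. With \<open>y = t x t\<^sup>-\<^sup>1\<close>, the relator \<open>\<rho>\<^sub>k\<close> gives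
  \<open>y x y\<^sup>-\<^sup>1 = x\<^bsup>k+1\<^esup>\<close>, hence \<open>y\<^sup>k x\<^sup>k y\<^bsup>-k\<^esup> = (x\<^sup>k)\<^bsup>(k+1)^k\<^esup>\<close>. But \<open>y\<^sup>k = t x\<^sup>k t\<^sup>-\<^sup>1\<close> lies in \<open>R\<close>, so
  it acts trivially on \<open>R\<close> modulo \<open>N\<close>, and \<open>x\<^sup>k\<close> has order dividing \<open>q\<^sub>k\<close> there. As the \<open>q\<^sub>k\<close> are
  pairwise coprime and the product of the \<open>x\<^sub>i\<^bsup>m\<^sub>i\<^esup>\<close> is trivial, each of them is trivial.\<close>

section \<open>Torsion from the relators\<close>

lemma (in group) conj_pow:
  assumes "x \<in> carrier G" "y \<in> carrier G"
  shows "(y \<otimes> x \<otimes> inv y) [^] (n::nat) = y \<otimes> x [^] n \<otimes> inv y"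
proof (induction n)
  case (Suc n)
  have "inv y \<otimes> (y \<otimes> (x \<otimes> inv y)) = x \<otimes> inv y"
    using assms by (simp flip: m_assoc)
  then show ?case using Suc assms by (simp add: m_assoc)
qed (use assms in simp)

text \<open>Conjugation by \<open>y\<close> is a homomorphism taking \<open>x\<close> to its
  \<open>d\<close>-th power, so each further conjugation multiplies the exponent by
  \<open>d\<close>.\<close>

lemma (in group) iterated_conj_pow:
  assumes x: "x \<in> carrier G" and y: "y \<in> carrier G"
    and conj: "y \<otimes> x \<otimes> inv y = x [^] (d::nat)"
  shows "y [^] (n::nat) \<otimes> x [^] (j::nat) \<otimes> inv (y [^] n) = x [^] (j * d ^ n)"
proof (induction n)
  case (Suc n)
  have "y [^] Suc n \<otimes> x [^] j \<otimes> inv (y [^] Suc n)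
      = y \<otimes> (y [^] n \<otimes> x [^] j \<otimes> inv (y [^] n)) \<otimes> inv y"
    unfolding nat_pow_Suc2[OF y] using x y by (simp add: inv_mult_group m_assoc)
  also have "\<dots> = (y \<otimes> x \<otimes> inv y) [^] (j * d ^ n)"
    unfolding Suc conj_pow[OF x y] ..
  also have "\<dots> = x [^] (j * d ^ Suc n)"
    unfolding conj using x by (simp add: nat_pow_pow ac_simps)
  finally show ?case .
qed (use x in simp)

lemma (in group) rho_closed:
  assumes "x \<in> carrier G" "t \<in> carrier G"
  shows "rho G k x t \<in> carrier G"
  using assms by (simp add: rho_def)

text \<open>With \<open>y\<close> the conjugate of \<open>x\<close> by \<open>t\<close>, conjugating
  \<open>x [^] k\<close> by \<open>y [^] k\<close> multiplies its exponent by
  \<open>(k + 1) ^ k\<close>. But \<open>comm\<close> says that this conjugation fixes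
  \<open>x [^] k\<close>, so the surplus exponent \<open>k * q k\<close> kills
  \<open>x\<close>.\<close>

lemma (in group) rho_torsion:
  assumes x: "x \<in> carrier G" and t: "t \<in> carrier G"
    and rho: "rho G k x t = \<one>"
    and comm: "(t \<otimes> x [^] k \<otimes> inv t) \<otimes> x [^] k = x [^] k \<otimes> (t \<otimes> x [^] k \<otimes> inv t)"
  shows "(x [^] k) [^] q k = \<one>"
proof -
  define y where "y = t \<otimes> x \<otimes> inv t"
  have y: "y \<in> carrier G" using x t by (simp add: y_def)
  \<comment> \<open>\<open>rho\<close> uses an integer exponent, whereas the iteration lemma works
    with natural powers.\<close>
  have "x [^] (- int k - 1) = inv (x [^] (k + 1))"
    using int_pow_neg_int[OF x, of "k + 1"]
    by (metis add_uminus_conv_diff minus_add_distrib of_nat_1 of_nat_add)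
  then have "y \<otimes> x \<otimes> inv y \<otimes> inv (x [^] (k + 1)) = \<one>"
    using rho by (simp add: rho_def y_def)
  then have "y \<otimes> x \<otimes> inv y = x [^] (k + 1)"
    using x y by (metis inv_closed inv_equality inv_inv m_closed nat_pow_closed)
  then have "y [^] k \<otimes> x [^] k \<otimes> inv (y [^] k) = x [^] (k * (k + 1) ^ k)"
    by (rule iterated_conj_pow[OF x y])
  moreover have "y [^] k \<otimes> x [^] k \<otimes> inv (y [^] k) = x [^] k"
    using comm x t by (simp add: y_def conj_pow m_assoc[of "x [^] k"])
  \<comment> \<open>The subtraction in \<open>q\<close> is truncated; it loses nothing because
    \<open>(k + 1) ^ k\<close> is positive.\<close>
  moreover have "k * (k + 1) ^ k = k + k * q k"
  proof -
    have "(k + 1) ^ k = Suc (q k)" by (simp add: q_def)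
    then show ?thesis by simp
  qed
  ultimately have "x [^] k \<otimes> x [^] (k * q k) = x [^] k"
    using x by (metis nat_pow_mult)
  then show ?thesis using x by (simp add: nat_pow_pow)
qed

text \<open>Raising the product to the power \<open>c\<close>, the product of all \<open>n i\<close>
  with \<open>i\<close> other than \<open>j\<close>, removes every factor except \<open>f j\<close>.
  Hence the order of \<open>f j\<close> divides both \<open>c\<close> and \<open>n j\<close>, which
  are coprime.\<close>

lemma (in comm_group) coprime_torsion_trivial:
  assumes I: "finite I" and f: "f \<in> I \<rightarrow> carrier G"
    and prod: "finprod G f I = \<one>"
    and tors: "\<And>i. i \<in> I \<Longrightarrow> f i [^] (n i :: nat) = \<one>"
    and cop: "\<And>i j. i \<in> I \<Longrightarrow> j \<in> I \<Longrightarrow> i \<noteq> j \<Longrightarrow> coprime (n i) (n j)"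
    and j: "j \<in> I"
  shows "f j = \<one>"
proof -
  define c where "c = (\<Prod>i\<in>I - {j}. n i)"
  have fc: "f i \<in> carrier G" if "i \<in> I" for i using f that by auto
  have rest: "finprod G (\<lambda>i. f i [^] c) (I - {j}) = \<one>"
  proof (rule finprod_one_eqI)
    fix i assume i: "i \<in> I - {j}"
    then have "n i dvd c" unfolding c_def using I by (intro dvd_prodI) auto
    then obtain d where "c = n i * d" by (elim dvdE)
    then show "f i [^] c = \<one>" using tors[of i] fc[of i] i by (simp flip: nat_pow_pow)
  qed
  have pow: "finprod G (\<lambda>i. f i [^] c) A = finprod G f A [^] c" if "finite A" "A \<subseteq> I" for A
    using that
  proof (induction A)
    case (insert a A)
    then have "f \<in> A \<rightarrow> carrier G" "(\<lambda>i. f i [^] c) \<in> A \<rightarrow> carrier G" "f a \<in> carrier G"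
      using fc by auto
    with insert show ?case by (simp add: nat_pow_distrib)
  qed simp
  have "finprod G (\<lambda>i. f i [^] c) (insert j (I - {j})) = f j [^] c"
    using I fc j rest by (subst finprod_insert) auto
  then have "f j [^] c = \<one>" using pow[OF I subset_refl] prod j by (simp add: insert_absorb)
  then have "ord (f j) dvd c" using fc[OF j] by (simp add: pow_eq_id)
  moreover have "ord (f j) dvd n j" using tors[OF j] fc[OF j] by (simp add: pow_eq_id)
  moreover have "coprime (n j) c"
    unfolding c_def using cop j by (intro prod_coprime_right) auto
  ultimately have "ord (f j) = 1" by (metis coprime_common_divisor_nat)
  then show ?thesis using pow_ord_eq_1[OF fc[OF j]] fc[OF j] by simp
qed

text \<open>Turns the ordered product of relators into an unordered one once it is read in an
  abelian group. Distinctness makes each list entry count once.\<close>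

lemma (in comm_monoid) foldr_mult_eq_finprod:
  assumes "distinct xs" "f \<in> set xs \<rightarrow> carrier G"
  shows "foldr (\<otimes>) (map f xs) \<one> = finprod G f (set xs)"
  using assms by (induction xs) (auto simp: Pi_iff)

lemma (in group_hom) hom_rho:
  assumes "x \<in> carrier G" "t \<in> carrier G"
  shows "h (rho G k x t) = rho H k (h x) (h t)"
  using assms by (simp add: rho_def hom_int_pow)

lemma (in monoid) foldr_mult_closed:
  assumes "f \<in> set xs \<rightarrow> carrier G"
  shows "foldr (\<otimes>) (map f xs) \<one> \<in> carrier G"
  using assms by (induction xs) auto

lemma (in group_hom) hom_foldr:
  assumes "f \<in> set xs \<rightarrow> carrier G"
  shows "h (foldr (\<otimes>) (map f xs) \<one>) = foldr (\<otimes>\<^bsub>H\<^esub>) (map (\<lambda>i. h (f i)) xs) \<one>\<^bsub>H\<^esub>"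
  using assms by (induction xs) (auto simp: G.foldr_mult_closed Pi_iff)

text \<open>The argument takes place in \<open>G Mod N\<close>, where the image of \<open>R\<close>
  is abelian because \<open>N\<close> contains the commutators of \<open>R\<close>. There the powers
  are torsion with pairwise coprime exponents and their product is trivial.\<close>

lemma (in group) powers_mem_normal:
  assumes N: "N \<lhd> G" and R: "R \<lhd> G" and DN: "derived G R \<subseteq> N"
    and x: "\<And>i. i \<in> set xs \<Longrightarrow> x i \<in> carrier G"
    and t: "\<And>i. i \<in> set xs \<Longrightarrow> t i \<in> carrier G"
    and xR: "\<And>i. i \<in> set xs \<Longrightarrow> x i [^] m i \<in> R"
    and rho: "\<And>i. i \<in> set xs \<Longrightarrow> rho G (m i) (x i) (t i) \<in> N"
    and prod: "foldr (\<otimes>) (map (\<lambda>i. x i [^] m i) xs) \<one> \<in> N"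
    and dist: "distinct xs"
    and cop: "\<And>i j. i \<in> set xs \<Longrightarrow> j \<in> set xs \<Longrightarrow> i \<noteq> j \<Longrightarrow> coprime (q (m i)) (q (m j))"
    and j: "j \<in> set xs"
  shows "x j [^] (m j :: nat) \<in> N"
proof -
  interpret N: normal N G by (rule N)
  interpret R: normal R G by (rule R)
  define \<pi> where "\<pi> = (\<lambda>a. N #> a)"
  define Q where "Q = G Mod N"
  \<comment> \<open>Two groups are kept: the relators involve \<open>x i\<close> and
    \<open>t i\<close>, which need not lie in \<open>R\<close>, so they are evaluated in
    \<open>Q\<close>; the powers \<open>x i [^] m i\<close> are compared in the abelian subgroup
    \<open>A\<close>.\<close>
  define A where "A = Q\<lparr>carrier := \<pi> ` R\<rparr>"
  have "group Q" unfolding Q_def by (rule N.factorgroup_is_group)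
  moreover have "\<pi> \<in> hom G Q" unfolding Q_def \<pi>_def by (rule N.r_coset_hom_Mod)
  ultimately interpret \<pi>: group_hom G Q \<pi>
    by (simp add: group_hom_def group_hom_axioms_def)
  have one_iff: "\<pi> a = \<one>\<^bsub>Q\<^esub> \<longleftrightarrow> a \<in> N" if "a \<in> carrier G" for a
    using that N.is_subgroup by (auto simp: \<pi>_def Q_def coset_join2 intro: coset_join1)
  have comm: "\<pi> a \<otimes>\<^bsub>Q\<^esub> \<pi> b = \<pi> b \<otimes>\<^bsub>Q\<^esub> \<pi> a" if a: "a \<in> R" and b: "b \<in> R" for a b
  proof -
    have "a \<otimes> b \<otimes> inv a \<otimes> inv b \<in> derived G R"
      unfolding derived_def using a b by (intro generate.incl) auto
    then have "\<pi> (a \<otimes> b \<otimes> inv a \<otimes> inv b) = \<one>\<^bsub>Q\<^esub>" using DN a b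
      by (subst one_iff) auto
    moreover have "a \<otimes> b = (a \<otimes> b \<otimes> inv a \<otimes> inv b) \<otimes> (b \<otimes> a)"
    proof -
      have "inv b \<otimes> (b \<otimes> a) = a" using a b by (simp flip: m_assoc)
      then show ?thesis using a b by (simp add: m_assoc)
    qed
    ultimately have "\<pi> (a \<otimes> b) = \<pi> (b \<otimes> a)" using a b
      by (metis R.mem_carrier R.m_closed R.m_inv_closed \<pi>.hom_mult \<pi>.H.l_one \<pi>.hom_closed)
    then show ?thesis using a b by simp
  qed
  have sub: "subgroup (\<pi> ` R) Q" by (rule \<pi>.subgroup_img_is_subgroup) (rule R.is_subgroup)
  have "group A" unfolding A_def by (rule \<pi>.H.subgroup_imp_group[OF sub])
  then interpret A: comm_group A
    by (rule group.group_comm_groupI) (auto simp: A_def comm)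
  define f where "f = (\<lambda>i. \<pi> (x i [^] m i))"
  have fA: "f \<in> set xs \<rightarrow> carrier A" using xR by (auto simp: f_def A_def)
  have tors: "f i [^]\<^bsub>A\<^esub> q (m i) = \<one>\<^bsub>A\<^esub>" if i: "i \<in> set xs" for i
  proof -
    \<comment> \<open>Normality of \<open>R\<close> puts the conjugate next to
      \<open>x i [^] m i\<close> in \<open>R\<close>, which yields the commutation required by
      \<open>rho_torsion\<close>.\<close>
    have "t i \<otimes> x i [^] m i \<otimes> inv (t i) \<in> R" using R.inv_op_closed2 t x xR i by auto
    then have "\<pi> (t i \<otimes> x i [^] m i \<otimes> inv (t i)) \<otimes>\<^bsub>Q\<^esub> \<pi> (x i [^] m i)
        = \<pi> (x i [^] m i) \<otimes>\<^bsub>Q\<^esub> \<pi> (t i \<otimes> x i [^] m i \<otimes> inv (t i))"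
      using xR i by (intro comm)
    moreover have "rho Q (m i) (\<pi> (x i)) (\<pi> (t i)) = \<one>\<^bsub>Q\<^esub>"
      using rho[OF i] x[OF i] t[OF i] by (simp add: one_iff rho_closed flip: \<pi>.hom_rho)
    ultimately have "(\<pi> (x i) [^]\<^bsub>Q\<^esub> m i) [^]\<^bsub>Q\<^esub> q (m i) = \<one>\<^bsub>Q\<^esub>"
      using x[OF i] t[OF i] by (intro \<pi>.H.rho_torsion[of _ "\<pi> (t i)"]) (auto simp: \<pi>.hom_nat_pow)
    then show ?thesis
      using x[OF i] by (simp add: f_def A_def \<pi>.hom_nat_pow flip: \<pi>.H.nat_pow_consistent)
  qed
  have "finprod A f (set xs) = foldr (\<otimes>\<^bsub>Q\<^esub>) (map f xs) \<one>\<^bsub>Q\<^esub>"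
    using A.foldr_mult_eq_finprod[OF dist fA] by (simp add: A_def)
  also have "\<dots> = \<pi> (foldr (\<otimes>) (map (\<lambda>i. x i [^] m i) xs) \<one>)"
    using \<pi>.hom_foldr[of "\<lambda>i. x i [^] m i" xs] x by (auto simp: f_def)
  also have "\<dots> = \<one>\<^bsub>A\<^esub>" using prod by (simp add: one_iff A_def)
  finally have "f j = \<one>\<^bsub>A\<^esub>"
    using fA tors cop j by (intro A.coprime_torsion_trivial[of "set xs" f "\<lambda>i. q (m i)"]) auto
  then show ?thesis using x[OF j] by (simp add: f_def A_def one_iff)
qed

section \<open>Submodules of the relation module\<close>

text \<open>Both records have the same carrier, product and unit, and inverses are defined from
  these alone.\<close>

lemma subgroup_add_monoid_relation_module:
  "subgroup H (add_monoid (relation_module F R)) \<longleftrightarrow> subgroup H (abelianization F R)"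
  by (simp add: relation_module_def subgroup_def m_inv_def)

lemma carrier_abelianization: "carrier (abelianization F R) = (\<lambda>w. derived F R #>\<^bsub>F\<^esub> w) ` R"
  by (auto simp: abelianization_def FactGroup_def RCOSETS_def r_coset_def)

text \<open>Makes the carrier itself a member of the family intersected in
  \<open>generated_submodule\<close>. Closure under scalars reduces to conjugates of elements of
  \<open>R\<close> staying in \<open>R\<close>.\<close>

lemma (in group) carrier_submodule_relation_module:
  assumes R: "R \<lhd> G"
  shows "submodule (carrier (relation_module G R)) (group_ring (G Mod R)) (relation_module G R)"
proof -
  interpret R: normal R G by (rule R)
  interpret A: comm_group "abelianization G R"
    by (rule comm_group_abelianization) (rule R.is_subgroup)
  have conj: "conj_action G g c \<in> carrier (abelianization G R)"
    if g: "g \<in> carrier (G Mod R)" and c: "c \<in> carrier (abelianization G R)" for g c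
  proof -
    from g obtain f where f: "f \<in> carrier G" "g = R #> f"
      by (auto simp: carrier_FactGroup)
    from c obtain w where w: "w \<in> R" "c = derived G R #> w" by (auto simp: carrier_abelianization)
    show ?thesis using conj_action_coset[OF R f(1) w(1)] R.inv_op_closed2[OF f(1) w(1)] f w
      by (auto simp: carrier_abelianization)
  qed
  show ?thesis
  proof (intro submodule.intro submodule_axioms.intro)
    show "subgroup (carrier (relation_module G R)) (add_monoid (relation_module G R))"
      unfolding subgroup_add_monoid_relation_module using A.subgroup_self by (simp add: relation_module_def)
  next
    fix a c assume "a \<in> carrier (group_ring (G Mod R))" "c \<in> carrier (relation_module G R)"
    then show "a \<odot>\<^bsub>relation_module G R\<^esub> c \<in> carrier (relation_module G R)"
      by (auto simp: relation_module_def group_ring_def intro!: A.finprod_closed A.int_pow_closed conj)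
  qed
qed

text \<open>\<open>N\<close> is the preimage of \<open>H\<close> under the projection of
  \<open>R\<close> onto its abelianization. Stability under conjugation by \<open>g\<close> comes
  from the scalar action of the class of \<open>g\<close> on \<open>H\<close>.\<close>

lemma (in group) preimage_submodule_normal:
  assumes R: "R \<lhd> G" and H: "submodule H (group_ring (G Mod R)) (relation_module G R)"
  defines "N \<equiv> {w \<in> R. derived G R #> w \<in> H}"
  shows "N \<lhd> G" and "derived G R \<subseteq> N"
proof -
  interpret R: normal R G by (rule R)
  interpret D: normal "derived G R" G by (rule derived_is_normal[OF R])
  interpret A: comm_group "abelianization G R"
    by (rule comm_group_abelianization) (rule R.is_subgroup)
  define \<delta> where "\<delta> w = derived G R #> w" for w
  have DR: "derived G R \<subseteq> R" by (rule derived_incl) (auto intro: R.is_subgroup)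
  have sub: "subgroup H (abelianization G R)"
    using submodule.axioms(1)[OF H] unfolding subgroup_add_monoid_relation_module .
  interpret H: subgroup H "abelianization G R" by (rule sub)
  have \<delta>_mult: "\<delta> v \<otimes>\<^bsub>abelianization G R\<^esub> \<delta> w = \<delta> (v \<otimes> w)" if "v \<in> R" "w \<in> R" for v w
    using D.rcos_sum[of v w] that
    by (simp add: \<delta>_def abelianization_def set_mult_def)
  have \<delta>_one: "\<one>\<^bsub>abelianization G R\<^esub> = derived G R"
    by (simp add: abelianization_def)
  have \<delta>_closed: "\<delta> w \<in> carrier (abelianization G R)" if "w \<in> R" for w
    using that by (simp add: carrier_abelianization \<delta>_def)
  have \<delta>_D: "\<delta> w = derived G R" if "w \<in> derived G R" for w
    using that D.rcos_const by (simp add: \<delta>_def)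
  have N_def': "N = {w \<in> R. \<delta> w \<in> H}" by (simp add: N_def \<delta>_def)
  show "derived G R \<subseteq> N"
    using DR \<delta>_D H.one_closed by (auto simp: N_def' \<delta>_one)
  have N_inv: "inv w \<in> N" if "w \<in> N" for w
  proof -
    have w: "w \<in> R" "\<delta> w \<in> H" using that by (auto simp: N_def')
    have "\<delta> (inv w) \<otimes>\<^bsub>abelianization G R\<^esub> \<delta> w = \<one>\<^bsub>abelianization G R\<^esub>"
      using w by (simp add: \<delta>_mult \<delta>_one \<delta>_D)
    then have "\<delta> (inv w) = inv\<^bsub>abelianization G R\<^esub> \<delta> w"
      using w by (intro A.inv_equality[symmetric] \<delta>_closed) auto
    then show ?thesis using w by (simp add: N_def')
  qed
  have "subgroup N G"
  proof (rule subgroupI)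
    show "N \<noteq> {}" using \<open>derived G R \<subseteq> N\<close> D.one_closed by blast
  next
    fix v w assume vw: "v \<in> N" "w \<in> N"
    then have "\<delta> v \<otimes>\<^bsub>abelianization G R\<^esub> \<delta> w \<in> H" by (simp add: N_def')
    then show "v \<otimes> w \<in> N" using vw by (simp add: N_def' \<delta>_mult)
  qed (use N_inv R.subset in \<open>auto simp: N_def'\<close>)
  moreover have "g \<otimes> w \<otimes> inv g \<in> N" if g: "g \<in> carrier G" and w: "w \<in> N" for g w
  proof -
    \<comment> \<open>The group element \<open>R #> g\<close>, viewed as a basis element of the
      group ring.\<close>
    define a :: "'a set \<Rightarrow> int" where "a = (\<lambda>h. if h = R #> g then 1 else 0)"
    have w': "w \<in> R" "\<delta> w \<in> H" using w by (auto simp: N_def')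
    have supp: "{h. a h \<noteq> 0} = {R #> g}" by (auto simp: a_def)
    have conjR: "g \<otimes> w \<otimes> inv g \<in> R" using R.inv_op_closed2 g w' by auto
    have conj: "conj_action G (R #> g) (\<delta> w) = \<delta> (g \<otimes> w \<otimes> inv g)"
      unfolding \<delta>_def by (rule conj_action_coset[OF R g w'(1)])
    have "a \<in> carrier (group_ring (G Mod R))"
      using g by (simp add: group_ring_def supp carrier_FactGroup)
    then have "a \<odot>\<^bsub>relation_module G R\<^esub> \<delta> w \<in> H"
      using w' by (intro submodule.smult_closed[OF H])
    moreover have "a \<odot>\<^bsub>relation_module G R\<^esub> \<delta> w = \<delta> (g \<otimes> w \<otimes> inv g)"
      \<comment> \<open>Unfolding \<open>a_def\<close> is left to the second \<open>simp\<close>, so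
        that \<open>supp\<close> can first reduce the product to a single factor.\<close>
      using \<delta>_closed[OF conjR] by (simp add: relation_module_def supp conj) (simp add: a_def conj)
    ultimately show ?thesis using conjR by (simp add: N_def')
  qed
  ultimately show "N \<lhd> G" unfolding normal_inv_iff by blast
qed

text \<open>The first two assumptions place the carrier among the intersected submodules; the third
  places it inside each of them.\<close>

lemma generated_submodule_eq_carrier:
  assumes "submodule (carrier M) K M" "A \<subseteq> carrier M"
    and "\<And>H. submodule H K M \<Longrightarrow> A \<subseteq> H \<Longrightarrow> carrier M \<subseteq> H"
  shows "generated_submodule K M A = carrier M"
  using assms unfolding generated_submodule_def by blast

theorem proposition3p4:
  fixes r :: nat and m :: "nat \<Rightarrow> nat"
  defines "F \<equiv> free_xt r"
  defines "R \<equiv> normal_closure F (relators r m)"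
  defines "\<Gamma> \<equiv> F Mod R"
  assumes "r \<ge> 1"
    and "\<And>i. i \<in> {1..r} \<Longrightarrow> m i \<ge> 1"
    and "\<And>i j. 1 \<le> i \<Longrightarrow> i < j \<Longrightarrow> j \<le> r \<Longrightarrow> coprime (q (m i)) (q (m j))"
  shows "generated_submodule (group_ring \<Gamma>) (relation_module F R)
           ((\<lambda>w. derived F R #>\<^bsub>F\<^esub> w) ` (rho_rel r m ` {1..r} \<union> {power_prod r m}))
         = carrier (relation_module F R)"
proof -
  interpret group F unfolding F_def free_xt_def by (rule group_free_group)
  have x: "letter (X i) \<in> carrier F" and t: "letter (T i) \<in> carrier F" if "i \<in> {1..r}" for i
    unfolding F_def free_xt_def using that by (auto intro!: letter_in_free_group)
  have rel: "relators r m \<subseteq> carrier F"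
    using x t by (auto simp: relators_def rho_rel_def power_rel_def rho_closed simp flip: F_def)
  have R: "R \<lhd> F" unfolding R_def by (rule normal_closure_normal[OF rel])
  interpret R: normal R F by (rule R)
  have relR: "relators r m \<subseteq> R" unfolding R_def normal_closure_def by auto
  then have rhoR: "rho_rel r m i \<in> R" and powR: "power_rel r m i \<in> R" if "i \<in> {1..r}" for i
    using that by (auto simp: relators_def)
  \<comment> \<open>Stated for arbitrary lists of indices so that induction on the list
    applies.\<close>
  have foldR: "foldr (\<otimes>\<^bsub>F\<^esub>) (map (power_rel r m) xs) \<one>\<^bsub>F\<^esub> \<in> R" if "set xs \<subseteq> {1..r}" for xs
    using that powR by (induction xs) auto
  have prodR: "power_prod r m \<in> R"
    using foldR[of "[1..<Suc r]"]
    by (simp add: power_prod_def F_def atLeastLessThanSuc_atLeastAtMost del: upt_Suc)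
  have carr: "carrier (relation_module F R) = (\<lambda>w. derived F R #>\<^bsub>F\<^esub> w) ` R"
    using carrier_abelianization by (simp add: relation_module_def)
  show ?thesis
  proof (rule generated_submodule_eq_carrier)
    show "submodule (carrier (relation_module F R)) (group_ring \<Gamma>) (relation_module F R)"
      unfolding \<Gamma>_def by (rule carrier_submodule_relation_module[OF R])
    show "(\<lambda>w. derived F R #>\<^bsub>F\<^esub> w) ` (rho_rel r m ` {1..r} \<union> {power_prod r m})
        \<subseteq> carrier (relation_module F R)"
      unfolding carr using rhoR prodR by (intro image_mono) auto
  next
    fix H assume H: "submodule H (group_ring \<Gamma>) (relation_module F R)"
      and gens: "(\<lambda>w. derived F R #>\<^bsub>F\<^esub> w) ` (rho_rel r m ` {1..r} \<union> {power_prod r m}) \<subseteq> H"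
    \<comment> \<open>It suffices to find all relators in this preimage: it is normal in
      \<open>F\<close>, and \<open>R\<close> is the least normal subgroup containing them.\<close>
    define N where "N = {w \<in> R. derived F R #>\<^bsub>F\<^esub> w \<in> H}"
    have N: "N \<lhd> F" "derived F R \<subseteq> N"
      unfolding N_def using H preimage_submodule_normal[OF R] by (simp_all add: \<Gamma>_def)
    have rhoN: "rho_rel r m i \<in> N" if "i \<in> {1..r}" for i
      using gens rhoR that by (auto simp: N_def)
    have prodN: "power_prod r m \<in> N" using gens prodR by (auto simp: N_def)
    have "power_rel r m j \<in> N" if "j \<in> {1..r}" for j
      unfolding power_rel_def F_def[symmetric]
    proof (rule powers_mem_normal[OF N(1) R N(2), where xs = "[1..<Suc r]" and m = m
          and x = "\<lambda>i. letter (X i)" and t = "\<lambda>i. letter (T i)"])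
      \<comment> \<open>Coprimality is given for increasing pairs of indices; symmetry covers the
        others.\<close>
      fix i k assume "i \<in> set [1..<Suc r]" "k \<in> set [1..<Suc r]" "i \<noteq> k"
      then show "coprime (q (m i)) (q (m k))"
        using assms(6)[of i k] assms(6)[of k i] by (cases "i < k") (auto simp: coprime_commute)
    next
      show "foldr (\<otimes>\<^bsub>F\<^esub>) (map (\<lambda>i. letter (X i) [^]\<^bsub>F\<^esub> m i) [1..<Suc r]) \<one>\<^bsub>F\<^esub> \<in> N"
        using prodN by (simp add: power_prod_def power_rel_def[abs_def] F_def del: upt_Suc)
    next
      fix i assume "i \<in> set [1..<Suc r]"
      then have i: "i \<in> {1..r}" by auto
      show "letter (X i) [^]\<^bsub>F\<^esub> m i \<in> R" using powR[OF i] by (simp add: power_rel_def F_def)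
      show "rho F (m i) (letter (X i)) (letter (T i)) \<in> N"
        using rhoN[OF i] by (simp add: rho_rel_def F_def)
      show "letter (X i) \<in> carrier F" "letter (T i) \<in> carrier F" using x t i by auto
    qed (use that in auto)
    then have "relators r m \<subseteq> N" using rhoN by (auto simp: relators_def)
    then have "R \<subseteq> N" using N(1) unfolding R_def normal_closure_def by auto
    then show "carrier (relation_module F R) \<subseteq> H" unfolding carr by (auto simp: N_def)
  qed
qed

end
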